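(* Let $B$ be a $C^*$-algebra, let $X$ be a Hilbert $C^*$-module over $B$, and let $P,Q\in\mathrm{End}^*_B(X)$ be projections ($P=P^*=P^2$, $Q=Q^*=Q^2$). Suppose that the sequence $(PQ)^n$ is Cauchy in the $*$-strong module topology. Then the sequences $(QP)^n$, $(PQP)^n$, $(QPQ)^n$, $(Q,P)_n$ and $(P,Q)_n$ are also Cauchy in the $*$-strong module topology. The $*$-strong limit of each of these sequences is a projection $P_\Omega$ with range $\Omega:=\mathrm{Ran}\,P\cap\mathrm{Ran}\,Q$. In particular, $\Omega$ is complemented in $X$.
   Context: $\mathrm{End}^*_B(X)$ is the unital $C^*$-algebra of adjointable operators on $X$. The $*$-strong module topology on it is defined by the seminorms $\|T\|_x:=\max\{\|Tx\|,\|T^*x\|\}$, $x\in X$. For projections $P,Q$ and $n\ge 0$, $(P,Q)_n:=\cdots PQPQ$ denotes the product of exactly $n$ alternating factors ending (on the right) in $Q$; $(Q,P)_n$ is the product of exactly $n$ alternating factors ending in $P$. A closed submodule $\Omega\subset X$ is complemented if $X=\Omega\oplus\Omega^\perp$, where $\Omega^\perp=\{x\in X:\langle x,y\rangle=0\ \forall y\in\Omega\}$. *)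

theory Defs
  imports Complex_Main
begin

class complex_vector = real_vector +
  fixes scaleC :: "complex \<Rightarrow> 'a \<Rightarrow> 'a"  (infixr "*\<^sub>C" 75)
  assumes scaleC_add_right: "c *\<^sub>C (x + y) = c *\<^sub>C x + c *\<^sub>C y"
    and scaleC_add_left: "(c + d) *\<^sub>C x = c *\<^sub>C x + d *\<^sub>C x"
    and scaleC_scaleC: "c *\<^sub>C d *\<^sub>C x = (c * d) *\<^sub>C x"
    and scaleC_one: "1 *\<^sub>C x = x"
    and scaleR_scaleC: "r *\<^sub>R x = complex_of_real r *\<^sub>C x"

class complex_normed_vector = complex_vector + real_normed_vector +
  assumes norm_scaleC: "norm (c *\<^sub>C x) = cmod c * norm x"

text \<open>Not necessarily unital.\<close>

class cstar_algebra = complex_normed_vector + real_normed_algebra + complete_space +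
  fixes star :: "'a \<Rightarrow> 'a"
  assumes mult_scaleC_left: "(c *\<^sub>C a) * b = c *\<^sub>C (a * b)"
    and mult_scaleC_right: "a * (c *\<^sub>C b) = c *\<^sub>C (a * b)"
    and star_add: "star (a + b) = star a + star b"
    and star_scaleC: "star (c *\<^sub>C a) = cnj c *\<^sub>C star a"
    and star_mult: "star (a * b) = star b * star a"
    and star_star: "star (star a) = a"
    and cstar_identity: "norm (star a * a) = (norm a)\<^sup>2"

definition cstar_positive :: "'b::cstar_algebra \<Rightarrow> bool" where
  "cstar_positive b \<longleftrightarrow> (\<exists>a. b = star a * a)"

text \<open>
  Right Hilbert C*-modules over \<open>'b\<close>, with inner product linear in the second variable.
  The carrier is a Banach space type whose norm is required to be the module norm, the square root
  of \<open>\<parallel>\<langle>x, x\<rangle>\<parallel>\<close>. That the module norm satisfies the triangle inequality is a theorem for every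
  pre-Hilbert module, so taking a normed type as carrier loses no generality; completeness is the
  class \<open>banach\<close>.
\<close>

locale hilbert_cstar_module =
  fixes ip :: "'x::{complex_normed_vector, banach} \<Rightarrow> 'x \<Rightarrow> 'b::cstar_algebra"
    and act :: "'x \<Rightarrow> 'b \<Rightarrow> 'x"
  assumes act_add_left: "act (x + y) b = act x b + act y b"
    and act_add_right: "act x (a + b) = act x a + act x b"
    and act_mult: "act x (a * b) = act (act x a) b"
    and act_scaleC_left: "act (c *\<^sub>C x) b = c *\<^sub>C act x b"
    and act_scaleC_right: "act x (c *\<^sub>C b) = c *\<^sub>C act x b"
    and ip_add_right: "ip x (y + z) = ip x y + ip x z"
    and ip_scaleC_right: "ip x (c *\<^sub>C y) = c *\<^sub>C ip x y"
    and ip_act_right: "ip x (act y b) = ip x y * b"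
    and star_ip: "star (ip x y) = ip y x"
    and ip_positive: "cstar_positive (ip x x)"
    and ip_definite: "ip x x = 0 \<Longrightarrow> x = 0"
    and norm_ip: "norm x = sqrt (norm (ip x x))"

text \<open>
  The operators below take the inner product as a parameter. An adjointable map is automatically
  bounded, complex linear and linear over the algebra, and its adjoint is unique.
\<close>

definition adjointable :: "('x \<Rightarrow> 'x \<Rightarrow> 'b) \<Rightarrow> ('x \<Rightarrow> 'x) \<Rightarrow> bool" where
  "adjointable ip T \<longleftrightarrow> (\<exists>S. \<forall>x y. ip (T x) y = ip x (S y))"

definition module_adjoint :: "('x \<Rightarrow> 'x \<Rightarrow> 'b) \<Rightarrow> ('x \<Rightarrow> 'x) \<Rightarrow> 'x \<Rightarrow> 'x" where
  "module_adjoint ip T = (THE S. \<forall>x y. ip (T x) y = ip x (S y))"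

definition module_projection :: "('x \<Rightarrow> 'x \<Rightarrow> 'b) \<Rightarrow> ('x \<Rightarrow> 'x) \<Rightarrow> bool" where
  "module_projection ip P \<longleftrightarrow> adjointable ip P \<and> module_adjoint ip P = P \<and> P \<circ> P = P"

definition star_strong_seminorm ::
    "('x::real_normed_vector \<Rightarrow> 'x \<Rightarrow> 'b) \<Rightarrow> 'x \<Rightarrow> ('x \<Rightarrow> 'x) \<Rightarrow> real" where
  "star_strong_seminorm ip x T = max (norm (T x)) (norm (module_adjoint ip T x))"

definition star_strong_Cauchy ::
    "('x::real_normed_vector \<Rightarrow> 'x \<Rightarrow> 'b) \<Rightarrow> (nat \<Rightarrow> 'x \<Rightarrow> 'x) \<Rightarrow> bool" where
  "star_strong_Cauchy ip T \<longleftrightarrow> (\<forall>n. adjointable ip (T n)) \<and>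
     (\<forall>x. \<forall>e>0. \<exists>N. \<forall>m\<ge>N. \<forall>n\<ge>N. star_strong_seminorm ip x (\<lambda>y. T m y - T n y) < e)"

definition star_strong_limit ::
    "('x::real_normed_vector \<Rightarrow> 'x \<Rightarrow> 'b) \<Rightarrow> (nat \<Rightarrow> 'x \<Rightarrow> 'x) \<Rightarrow> ('x \<Rightarrow> 'x) \<Rightarrow> bool" where
  "star_strong_limit ip T L \<longleftrightarrow> (\<forall>n. adjointable ip (T n)) \<and> adjointable ip L \<and>
     (\<forall>x. (\<lambda>n. star_strong_seminorm ip x (\<lambda>y. T n y - L y)) \<longlonglongrightarrow> 0)"

text \<open>\<open>alt_prod P Q n\<close> is \<open>\<cdots>PQPQ\<close>, with exactly \<open>n\<close> factors, the rightmost one being \<open>Q\<close>.\<close>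

fun alt_prod :: "('x \<Rightarrow> 'x) \<Rightarrow> ('x \<Rightarrow> 'x) \<Rightarrow> nat \<Rightarrow> 'x \<Rightarrow> 'x" where
  "alt_prod P Q 0 = id"
| "alt_prod P Q (Suc n) = alt_prod Q P n \<circ> Q"

definition closed_submodule ::
    "('x::complex_normed_vector \<Rightarrow> 'b \<Rightarrow> 'x) \<Rightarrow> 'x set \<Rightarrow> bool" where
  "closed_submodule act W \<longleftrightarrow> closed W \<and> 0 \<in> W \<and> (\<forall>x\<in>W. \<forall>y\<in>W. x + y \<in> W) \<and>
     (\<forall>c. \<forall>x\<in>W. c *\<^sub>C x \<in> W) \<and> (\<forall>x\<in>W. \<forall>b. act x b \<in> W)"

definition module_orthogonal :: "('x \<Rightarrow> 'x \<Rightarrow> 'b::zero) \<Rightarrow> 'x set \<Rightarrow> 'x set" where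
  "module_orthogonal ip W = {x. \<forall>y\<in>W. ip x y = 0}"

definition complemented ::
    "('x::complex_normed_vector \<Rightarrow> 'x \<Rightarrow> 'b::zero) \<Rightarrow> ('x \<Rightarrow> 'b \<Rightarrow> 'x) \<Rightarrow> 'x set \<Rightarrow> bool" where
  "complemented ip act W \<longleftrightarrow> closed_submodule act W \<and> W \<inter> module_orthogonal ip W = {0} \<and>
     (\<forall>x. \<exists>u\<in>W. \<exists>v\<in>module_orthogonal ip W. x = u + v)"

end

theory Submission
  imports Defs
begin

text \<open>
  Let \<open>A\<close> and \<open>C\<close> be the strong limits of \<open>(PQ)\<^sup>n\<close> and \<open>(QP)\<^sup>n\<close>; they are adjoint to each other, and
  \<open>PQA = A\<close>. A vector \<open>y\<close> with \<open>PQy = y\<close> lies in both ranges: for \<open>z = y - Qy\<close> one has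
  \<open>Pz = 0 = Qz\<close>, so \<open>\<langle>z, z\<rangle> = \<langle>z, y\<rangle> = \<langle>Pz, y\<rangle> = 0\<close>. Hence \<open>A\<close> and \<open>C\<close> map into
  \<open>\<Omega>\<close>, which they fix pointwise. So \<open>C = AC\<close>, and \<open>AC\<close> is self-adjoint, whence \<open>A = C\<close> is the
  projection onto \<open>\<Omega>\<close>. The other sequences are obtained from these two by multiplication with \<open>P\<close>
  or \<open>Q\<close>, which \<open>A\<close> absorbs. The Cauchy-Schwarz inequality, and with it the positive cone of the
  algebra, is avoided: \<open>2P - 1\<close> is isometric, so \<open>P\<close> is a contraction, and polarization
  makes the inner product continuous.
\<close>

section \<open>Adjoint pairs, scalars, and iterates of compositions\<close>

text \<open>As a relation, adjointness can be composed, iterated and subtracted by direct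
  calculation, without the definite description in \<open>module_adjoint\<close>;
  \<open>module_adjoint_eq\<close> translates back.\<close>

definition adjoint_pair :: "('x \<Rightarrow> 'x \<Rightarrow> 'b) \<Rightarrow> ('x \<Rightarrow> 'x) \<Rightarrow> ('x \<Rightarrow> 'x) \<Rightarrow> bool" where
  "adjoint_pair ip T S \<longleftrightarrow> (\<forall>x y. ip (T x) y = ip x (S y))"

lemma adjoint_pairD: "adjoint_pair ip T S \<Longrightarrow> ip (T x) y = ip x (S y)"
  by (simp add: adjoint_pair_def)

lemma adjoint_pair_comp:
  "adjoint_pair ip T S \<Longrightarrow> adjoint_pair ip T' S' \<Longrightarrow> adjoint_pair ip (T \<circ> T') (S' \<circ> S)"
  by (simp add: adjoint_pair_def)

lemma adjoint_pair_funpow: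
  assumes "adjoint_pair ip T S"
  shows "adjoint_pair ip (T ^^ n) (S ^^ n)"
proof (induction n)
  case 0
  show ?case by (simp add: adjoint_pair_def)
next
  case (Suc n)
  show ?case
    using adjoint_pair_comp[OF assms Suc] by (metis funpow.simps(2) funpow_Suc_right)
qed

lemma scaleC_minus_one: "(-1) *\<^sub>C x = - (x::'a::complex_vector)"
  using scaleR_scaleC[of "-1" x] by simp

lemma scaleC_minus_right: "c *\<^sub>C (- x) = - (c *\<^sub>C (x::'a::complex_vector))"
  by (metis mult.commute scaleC_minus_one scaleC_scaleC)

lemma scaleC_minus_left: "(- c) *\<^sub>C x = - (c *\<^sub>C (x::'a::complex_vector))"
  using scaleC_scaleC[of "-1" c x] by (simp add: scaleC_minus_one)

lemma funpow_comp_shift: "((f \<circ> g) ^^ n) (f x) = f (((g \<circ> f) ^^ n) x)"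
  by (induction n) auto

text \<open>Adjacent copies of \<open>f\<close> between consecutive factors merge. The exponent is
  \<open>Suc n\<close> because at exponent 0 the two sides would be \<open>x\<close> and
  \<open>f x\<close>.\<close>

lemma funpow_comp_idem:
  assumes "f \<circ> f = f"
  shows "((f \<circ> g \<circ> f) ^^ Suc n) x = ((f \<circ> g) ^^ Suc n) (f x)"
proof (induction n)
  case (Suc n)
  have "f (f u) = f u" for u
    using fun_cong[OF assms, of u] by simp
  with Suc show ?case by simp
qed simp

lemma funpow_fixed: "f x = x \<Longrightarrow> (f ^^ n) x = x"
  by (induction n) auto

text \<open>Meant for alternating products, whose terms of even and odd length have different closed
  forms.\<close>

lemma tendsto_even_odd:
  assumes "(\<lambda>n. f (2 * n)) \<longlonglongrightarrow> l" and "(\<lambda>n. f (Suc (2 * n))) \<longlonglongrightarrow> l"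
  shows "f \<longlonglongrightarrow> l"
proof (rule topological_tendstoI)
  fix S
  assume "open S" "l \<in> S"
  then obtain M N where M: "\<And>n. n \<ge> M \<Longrightarrow> f (2 * n) \<in> S"
    and N: "\<And>n. n \<ge> N \<Longrightarrow> f (Suc (2 * n)) \<in> S"
    using topological_tendstoD[OF assms(1)] topological_tendstoD[OF assms(2)]
    unfolding eventually_sequentially by meson
  show "\<forall>\<^sub>F n in sequentially. f n \<in> S"
  proof (rule eventually_sequentiallyI)
    fix n
    assume n: "n \<ge> 2 * M + Suc (2 * N)"
    show "f n \<in> S"
    proof (cases "even n")
      case True
      then obtain k where "n = 2 * k" ..
      with n M[of k] show ?thesis by simp
    next
      case False
      then obtain k where "n = Suc (2 * k)"
        by (metis oddE Suc_eq_plus1)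
      with n N[of k] show ?thesis by simp
    qed
  qed
qed

text \<open>Each recursion step splits off the rightmost factor and swaps the roles of
  \<open>P\<close> and \<open>Q\<close>, so two steps split off one factor
  \<open>P \<circ> Q\<close> on the right.\<close>

lemma alt_prod_even: "alt_prod P Q (2 * k) = (P \<circ> Q) ^^ k"
proof (induction k)
  case (Suc k)
  have "alt_prod P Q (2 * Suc k) = alt_prod P Q (2 * k) \<circ> P \<circ> Q" by simp
  with Suc show ?case by (simp only: funpow_Suc_right o_assoc)
qed simp

lemma alt_prod_odd: "alt_prod P Q (Suc (2 * k)) = (Q \<circ> P) ^^ k \<circ> Q"
  by (simp add: alt_prod_even)

context hilbert_cstar_module
begin

section \<open>Sesquilinearity and continuity of the inner product\<close>

lemma ip_add_left: "ip (x + y) z = ip x z + ip y z"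
  by (metis ip_add_right star_add star_ip)

lemma ip_scaleC_left: "ip (c *\<^sub>C x) z = cnj c *\<^sub>C ip x z"
  by (metis ip_scaleC_right star_scaleC star_ip)

lemma ip_zero_right [simp]: "ip x 0 = 0"
  using ip_add_right[of x 0 0] by simp

lemma ip_zero_left [simp]: "ip 0 x = 0"
  using ip_add_left[of 0 0 x] by simp

lemma ip_diff_right: "ip x (y - z) = ip x y - ip x z"
  using ip_add_right[of x "y - z" z] by simp

lemma ip_diff_left: "ip (y - z) x = ip y x - ip z x"
  using ip_add_left[of "y - z" z x] by simp

lemma ip_scaleR_right: "ip x (r *\<^sub>R y) = r *\<^sub>R ip x y"
  by (simp add: scaleR_scaleC ip_scaleC_right)

lemma ip_scaleR_left: "ip (r *\<^sub>R x) y = r *\<^sub>R ip x y"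
  by (simp add: scaleR_scaleC ip_scaleC_left)

lemma ip_left_eqI:
  assumes "\<And>z. ip z x = ip z y"
  shows "x = y"
  using ip_definite[of "x - y"] assms by (simp add: ip_diff_right)

lemma ip_right_eqI:
  assumes "\<And>z. ip x z = ip y z"
  shows "x = y"
  using ip_definite[of "x - y"] assms by (simp add: ip_diff_left)

lemma norm_ip_self: "norm (ip x x) = (norm x)\<^sup>2"
  by (simp add: norm_ip)

text \<open>The first difference is twice the sum of \<open>ip x y\<close> and
  \<open>ip y x\<close>. Replacing \<open>y\<close> by \<open>\<i> *\<^sub>C y\<close> yields
  \<open>\<i>\<close> times twice their difference, since the first variable is conjugate linear;
  the coefficient \<open>- \<i>\<close> removes that factor.\<close>

lemma ip_polarization:
  "4 *\<^sub>R ip x y = (ip (x + y) (x + y) - ip (x - y) (x - y))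
    + (- \<i>) *\<^sub>C (ip (x + \<i> *\<^sub>C y) (x + \<i> *\<^sub>C y) - ip (x - \<i> *\<^sub>C y) (x - \<i> *\<^sub>C y))"
proof -
  have 1: "ip (x + u) (x + u) - ip (x - u) (x - u) = 2 *\<^sub>R (ip x u + ip u x)" for u
    by (simp add: ip_add_left ip_add_right ip_diff_left ip_diff_right scaleR_2 algebra_simps)
  have i_2_i: "\<i> * (2 * \<i>) = - 2" by simp
  have 2: "(- \<i>) *\<^sub>C (2 *\<^sub>R (ip x (\<i> *\<^sub>C y) + ip (\<i> *\<^sub>C y) x)) = 2 *\<^sub>R (ip x y - ip y x)"
    by (simp add: ip_scaleC_left ip_scaleC_right scaleR_scaleC scaleC_add_right
        scaleC_scaleC i_2_i scaleC_minus_left scaleC_minus_right diff_conv_add_uminus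
        del: add_uminus_conv_diff)
  have "4 *\<^sub>R ip x y = 2 *\<^sub>R (ip x y + ip y x) + 2 *\<^sub>R (ip x y - ip y x)"
    by (simp add: algebra_simps flip: scaleR_add_left)
  then show ?thesis
    by (simp only: 1 2)
qed

text \<open>A crude substitute for Cauchy-Schwarz: each of the four terms in the polarization
  identity is the inner product of a vector with itself, hence has norm at most the squared sum of
  norms.\<close>

lemma norm_ip_le_square: "norm (ip x y) \<le> (norm x + norm y)\<^sup>2"
proof -
  have plus: "norm (ip (x + u) (x + u)) \<le> (norm x + norm u)\<^sup>2" for u
    by (simp add: norm_ip_self norm_triangle_ineq power_mono)
  have minus: "norm (ip (x - u) (x - u)) \<le> (norm x + norm u)\<^sup>2" for u
    by (simp add: norm_ip_self norm_triangle_ineq4 power_mono)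
  have diff: "norm (ip (x + u) (x + u) - ip (x - u) (x - u)) \<le> 2 * (norm x + norm u)\<^sup>2" for u
    using norm_triangle_ineq4[of "ip (x + u) (x + u)" "ip (x - u) (x - u)"] plus[of u] minus[of u]
    by linarith
  have "norm (4 *\<^sub>R ip x y) \<le> norm (ip (x + y) (x + y) - ip (x - y) (x - y))
    + norm ((- \<i>) *\<^sub>C (ip (x + \<i> *\<^sub>C y) (x + \<i> *\<^sub>C y) - ip (x - \<i> *\<^sub>C y) (x - \<i> *\<^sub>C y)))"
    unfolding ip_polarization by (rule norm_triangle_ineq)
  also have "\<dots> \<le> 2 * (norm x + norm y)\<^sup>2 + 2 * (norm x + norm y)\<^sup>2"
    using diff[of y] diff[of "\<i> *\<^sub>C y"] by (simp add: norm_scaleC)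
  finally show ?thesis by simp
qed

text \<open>The quadratic bound becomes linear in \<open>y\<close> once it is applied to the unit
  vector \<open>y /\<^sub>R norm y\<close> and scaled back.\<close>

lemma bounded_linear_ip_right: "bounded_linear (ip x)"
proof (rule bounded_linear_intro[where K = "(norm x + 1)\<^sup>2"])
  fix y
  show "norm (ip x y) \<le> norm y * (norm x + 1)\<^sup>2"
  proof (cases "y = 0")
    case False
    have "ip x y = norm y *\<^sub>R ip x (y /\<^sub>R norm y)"
      using False by (simp add: ip_scaleR_right)
    moreover have "norm (ip x (y /\<^sub>R norm y)) \<le> (norm x + 1)\<^sup>2"
      using norm_ip_le_square[of x "y /\<^sub>R norm y"] False by simp
    ultimately show ?thesis
      by (simp add: mult_left_mono)
  qed simp
qed (simp_all add: ip_add_right ip_scaleR_right)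

lemma bounded_linear_ip_left: "bounded_linear (\<lambda>x. ip x y)"
proof (rule bounded_linear_intro[where K = "(norm y + 1)\<^sup>2"])
  fix x
  show "norm (ip x y) \<le> norm x * (norm y + 1)\<^sup>2"
  proof (cases "x = 0")
    case False
    have "ip x y = norm x *\<^sub>R ip (x /\<^sub>R norm x) y"
      using False by (simp add: ip_scaleR_left)
    moreover have "norm (ip (x /\<^sub>R norm x) y) \<le> (norm y + 1)\<^sup>2"
      using norm_ip_le_square[of "x /\<^sub>R norm x" y] False by (simp add: add.commute)
    ultimately show ?thesis
      by (simp add: mult_left_mono)
  qed simp
qed (simp_all add: ip_add_left ip_scaleR_left)

section \<open>Adjoints, projections and the star-strong topology\<close>

lemma module_adjoint_eq:
  assumes "adjoint_pair ip T S"
  shows "module_adjoint ip T = S"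
  unfolding module_adjoint_def
proof (rule the_equality)
  show "\<forall>x y. ip (T x) y = ip x (S y)"
    using assms by (simp add: adjoint_pair_def)
next
  fix S'
  assume "\<forall>x y. ip (T x) y = ip x (S' y)"
  then have "ip z (S' y) = ip z (S y)" for z y
    using adjoint_pairD[OF assms] by metis
  then show "S' = S"
    by (intro ext ip_left_eqI)
qed

lemma adjoint_pair_module_adjoint:
  assumes "adjointable ip T"
  shows "adjoint_pair ip T (module_adjoint ip T)"
  using assms module_adjoint_eq unfolding adjointable_def adjoint_pair_def by metis

lemma adjoint_pair_sym:
  assumes "adjoint_pair ip T S"
  shows "adjoint_pair ip S T"
  using adjoint_pairD[OF assms] unfolding adjoint_pair_def by (metis star_ip)

lemma adjoint_pair_diff:
  "adjoint_pair ip T S \<Longrightarrow> adjoint_pair ip T' S' \<Longrightarrow>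
    adjoint_pair ip (\<lambda>x. T x - T' x) (\<lambda>x. S x - S' x)"
  by (simp add: adjoint_pair_def ip_diff_left ip_diff_right)

lemma module_projection_iff:
  "module_projection ip P \<longleftrightarrow> adjoint_pair ip P P \<and> P \<circ> P = P"
proof
  assume "module_projection ip P"
  then show "adjoint_pair ip P P \<and> P \<circ> P = P"
    using adjoint_pair_module_adjoint[of P] by (simp add: module_projection_def)
next
  assume P: "adjoint_pair ip P P \<and> P \<circ> P = P"
  then have "adjointable ip P"
    by (auto simp: adjointable_def adjoint_pair_def)
  with P show "module_projection ip P"
    by (simp add: module_projection_def module_adjoint_eq)
qed

lemma projection_adjoint: "module_projection ip P \<Longrightarrow> ip (P x) y = ip x (P y)"
  by (simp add: module_projection_iff adjoint_pair_def)

lemma projection_idem: "module_projection ip P \<Longrightarrow> P (P x) = P x"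
  by (metis comp_apply module_projection_iff)

lemma star_strong_seminorm_eq:
  "adjoint_pair ip T S \<Longrightarrow> star_strong_seminorm ip x T = max (norm (T x)) (norm (S x))"
  by (simp add: star_strong_seminorm_def module_adjoint_eq)

text \<open>The seminorm of \<open>T n - L\<close> at \<open>x\<close> is the larger of two
  distances, one for the operators and one for their adjoints, so pointwise convergence of both
  sequences is enough.\<close>

lemma star_strong_limitI:
  assumes T: "\<And>n. adjoint_pair ip (T n) (S n)" and L: "adjoint_pair ip L M"
    and lim: "\<And>x. (\<lambda>n. T n x) \<longlonglongrightarrow> L x" "\<And>x. (\<lambda>n. S n x) \<longlonglongrightarrow> M x"
  shows "star_strong_limit ip T L"
proof -
  have "(\<lambda>n. star_strong_seminorm ip x (\<lambda>y. T n y - L y)) \<longlonglongrightarrow> 0" for x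
  proof -
    have "(\<lambda>n. max (norm (T n x - L x)) (norm (S n x - M x)))
      \<longlonglongrightarrow> max (norm (L x - L x)) (norm (M x - M x))"
      by (intro tendsto_intros lim)
    then show ?thesis
      by (simp add: star_strong_seminorm_eq[OF adjoint_pair_diff[OF T L]])
  qed
  moreover have "adjointable ip (T n)" for n
    using T[of n] by (auto simp: adjointable_def adjoint_pair_def)
  moreover have "adjointable ip L"
    using L by (auto simp: adjointable_def adjoint_pair_def)
  ultimately show ?thesis
    by (simp add: star_strong_limit_def)
qed

text \<open>The triangle inequality for the seminorms, applied to the operators and to their
  adjoints. All Cauchy claims of the final theorem are reduced to limits in this way.\<close>

lemma star_strong_limit_imp_Cauchy:
  assumes "star_strong_limit ip T L"
  shows "star_strong_Cauchy ip T"
  unfolding star_strong_Cauchy_def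
proof (intro conjI allI impI)
  show adj: "adjointable ip (T n)" for n
    using assms by (simp add: star_strong_limit_def)
  fix x and e :: real
  assume "e > 0"
  define d where "d n = star_strong_seminorm ip x (\<lambda>y. T n y - L y)" for n
  have "d \<longlonglongrightarrow> 0"
    using assms unfolding d_def star_strong_limit_def by blast
  then have "\<forall>\<^sub>F n in sequentially. d n < e / 2"
    using \<open>e > 0\<close> by (intro order_tendstoD(2)) auto
  then obtain N where N: "d n < e / 2" if "n \<ge> N" for n
    unfolding eventually_sequentially by blast
  have aT: "adjoint_pair ip (T n) (module_adjoint ip (T n))" for n
    by (rule adjoint_pair_module_adjoint[OF adj])
  have aL: "adjoint_pair ip L (module_adjoint ip L)"
    using assms by (intro adjoint_pair_module_adjoint) (simp add: star_strong_limit_def)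
  have "star_strong_seminorm ip x (\<lambda>y. T m y - T n y) \<le> d m + d n" for m n
    using norm_triangle_ineq4[of "T m x - L x" "T n x - L x"]
      norm_triangle_ineq4[of "module_adjoint ip (T m) x - module_adjoint ip L x"
        "module_adjoint ip (T n) x - module_adjoint ip L x"]
    by (simp add: d_def star_strong_seminorm_eq[OF adjoint_pair_diff[OF aT aL]]
        star_strong_seminorm_eq[OF adjoint_pair_diff[OF aT aT]]) linarith
  then show "\<exists>N. \<forall>m\<ge>N. \<forall>n\<ge>N. star_strong_seminorm ip x (\<lambda>y. T m y - T n y) < e"
    using N by (smt (verit) field_sum_of_halves)
qed

text \<open>The seminorm dominates the norm differences of both sequences at \<open>x\<close>, and
  the carrier is complete.\<close>

lemma star_strong_Cauchy_convergent:
  assumes "star_strong_Cauchy ip T" and T: "\<And>n. adjoint_pair ip (T n) (S n)"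
  shows "convergent (\<lambda>n. T n x)" "convergent (\<lambda>n. S n x)"
proof -
  have *: "\<exists>N. \<forall>m\<ge>N. \<forall>n\<ge>N. max (norm (T m x - T n x)) (norm (S m x - S n x)) < e"
    if "e > 0" for e
    using assms(1) that unfolding star_strong_Cauchy_def
    by (simp only: star_strong_seminorm_eq[OF adjoint_pair_diff[OF T T]])
  show "convergent (\<lambda>n. T n x)" "convergent (\<lambda>n. S n x)"
    unfolding Cauchy_convergent_iff[symmetric] by (rule CauchyI, use * in force)+
qed

section \<open>Linearity of adjointable maps, and ranges of projections\<close>

lemma adjoint_pair_add:
  "adjoint_pair ip T S \<Longrightarrow> T (x + y) = T x + T y"
  by (rule ip_right_eqI) (simp add: adjoint_pairD ip_add_left)

lemma adjoint_pair_scaleC: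
  "adjoint_pair ip T S \<Longrightarrow> T (c *\<^sub>C x) = c *\<^sub>C T x"
  by (rule ip_right_eqI) (simp add: adjoint_pairD ip_scaleC_left)

lemma adjoint_pair_act:
  assumes "adjoint_pair ip T S"
  shows "T (act x b) = act (T x) b"
proof (rule ip_left_eqI)
  fix z
  have "ip z (T (act x b)) = ip (S z) (act x b)"
    using adjoint_pairD[OF adjoint_pair_sym[OF assms]] by simp
  also have "\<dots> = ip z (act (T x) b)"
    using adjoint_pairD[OF adjoint_pair_sym[OF assms]] by (simp add: ip_act_right)
  finally show "ip z (T (act x b)) = ip z (act (T x) b)" .
qed

lemma projection_contractive:
  assumes "module_projection ip P"
  shows "norm (P x) \<le> norm x"
proof -
  note adj = projection_adjoint[OF assms] and idem = projection_idem[OF assms]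
  let ?u = "(P x + P x) - x"
  \<comment> \<open>Here \<open>?u\<close> is the image of \<open>x\<close> under
    \<open>2P - 1\<close>, and \<open>P x\<close> is the midpoint of \<open>?u\<close> and
    \<open>x\<close>.\<close>
  have "ip ?u ?u = ip x x"
    by (simp add: ip_diff_left ip_diff_right ip_add_left ip_add_right adj idem)
  then have "norm ?u = norm x"
    by (simp add: norm_ip)
  moreover have "2 *\<^sub>R P x = ?u + x"
    by (simp add: scaleR_2)
  ultimately have "norm (2 *\<^sub>R P x) \<le> norm x + norm x"
    using norm_triangle_ineq[of ?u x] by metis
  then show ?thesis by simp
qed

lemma bounded_linear_projection:
  assumes "module_projection ip P"
  shows "bounded_linear P"
proof (rule bounded_linear_intro[where K = 1])
  have P: "adjoint_pair ip P P"
    using assms by (simp add: module_projection_iff)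
  show "P (x + y) = P x + P y" for x y
    by (rule adjoint_pair_add[OF P])
  show "P (r *\<^sub>R x) = r *\<^sub>R P x" for r x
    by (simp add: scaleR_scaleC adjoint_pair_scaleC[OF P])
  show "norm (P x) \<le> norm x * 1" for x
    using projection_contractive[OF assms] by simp
qed

lemma projection_fixed:
  assumes "module_projection ip P"
  shows "x \<in> range P \<longleftrightarrow> P x = x"
  using assms by (metis comp_apply module_projection_iff rangeE rangeI)

text \<open>The range is the fixed-point set of a continuous map that is linear over both the
  scalars and the algebra.\<close>

lemma closed_submodule_range_projection:
  assumes "module_projection ip P"
  shows "closed_submodule act (range P)"
proof -
  have P: "adjoint_pair ip P P"
    using assms by (simp add: module_projection_iff)
  interpret bounded_linear P
    by (rule bounded_linear_projection[OF assms])
  have "range P = {x. P x = x}"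
    using projection_fixed[OF assms] by auto
  moreover have "closed {x. P x = x}"
    by (intro closed_Collect_eq continuous_on continuous_on_id)
  ultimately show ?thesis
    by (auto simp: closed_submodule_def zero add adjoint_pair_scaleC[OF P] adjoint_pair_act[OF P])
qed

lemma complemented_range_projection:
  assumes "module_projection ip P"
  shows "complemented ip act (range P)"
proof -
  note adj = projection_adjoint[OF assms] and idem = projection_idem[OF assms]
  have sub: "closed_submodule act (range P)"
    by (rule closed_submodule_range_projection[OF assms])
  have "x - P x \<in> module_orthogonal ip (range P)" for x
    by (auto simp: module_orthogonal_def ip_diff_left adj idem)
  then have "\<exists>u\<in>range P. \<exists>v\<in>module_orthogonal ip (range P). x = u + v" for x
    by (intro bexI[of _ "P x"] bexI[of _ "x - P x"]) auto
  moreover have "range P \<inter> module_orthogonal ip (range P) = {0}"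
    using sub ip_definite by (auto simp: module_orthogonal_def closed_submodule_def)
  ultimately show ?thesis
    using sub by (simp add: complemented_def)
qed

section \<open>Limits of alternating products of two projections\<close>

lemma fixed_of_projection_product:
  assumes P: "module_projection ip P" and Q: "module_projection ip Q" and y: "P (Q y) = y"
  shows "P y = y" "Q y = y"
proof -
  show Py: "P y = y"
    using projection_idem[OF P, of "Q y"] y by simp
  let ?z = "y - Q y"
  have "P ?z = 0" "Q ?z = 0"
    using Py y projection_idem[OF Q, of y]
    by (simp_all add: linear_diff bounded_linear.linear bounded_linear_projection P Q)
  \<comment> \<open>Self-adjointness moves \<open>P\<close> and \<open>Q\<close> onto
    \<open>?z\<close>, which both annihilate. As \<open>P y = y\<close>, these are the two terms of
    \<open>ip ?z ?z\<close> expanded in its second argument.\<close>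
  then have "ip ?z (P y) = 0" "ip ?z (Q y) = 0"
    by (simp_all flip: projection_adjoint[OF P] projection_adjoint[OF Q])
  then have "ip ?z ?z = 0"
    by (subst ip_diff_right) (simp add: Py)
  then show "Q y = y"
    using ip_definite by force
qed

text \<open>For positive \<open>n\<close>, the power of \<open>P \<circ> Q \<circ> P\<close> is that
  of \<open>P \<circ> Q\<close> applied after \<open>P\<close>, and \<open>L\<close> absorbs
  \<open>P\<close>. These powers are self-adjoint, so one pointwise limit serves for the adjoints
  too. Exchanging \<open>P\<close> and \<open>Q\<close> covers the other sequence.\<close>

lemma star_strong_limit_PQP:
  assumes P: "module_projection ip P" and Q: "module_projection ip Q"
    and L: "adjoint_pair ip L L" "\<And>x. L (P x) = L x"
    and lim: "\<And>x. (\<lambda>n. ((P \<circ> Q) ^^ n) x) \<longlonglongrightarrow> L x"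
  shows "star_strong_limit ip (\<lambda>n. (P \<circ> Q \<circ> P) ^^ n) L"
proof -
  have "adjoint_pair ip (P \<circ> Q \<circ> P) (P \<circ> Q \<circ> P)"
    using adjoint_pair_comp[OF adjoint_pair_comp[of ip P P Q Q], of P P] P Q
    by (simp add: module_projection_iff o_assoc)
  moreover have "(\<lambda>n. ((P \<circ> Q \<circ> P) ^^ n) x) \<longlonglongrightarrow> L x" for x
  proof (rule LIMSEQ_imp_Suc)
    have idem: "P \<circ> P = P"
      using P by (simp add: module_projection_iff)
    show "(\<lambda>n. ((P \<circ> Q \<circ> P) ^^ Suc n) x) \<longlonglongrightarrow> L x"
      using LIMSEQ_Suc[OF lim[of "P x"]] by (simp only: funpow_comp_idem[OF idem] L(2))
  qed
  ultimately show ?thesis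
    using L(1) by (intro star_strong_limitI[where M = L and S = "\<lambda>n. (P \<circ> Q \<circ> P) ^^ n"] adjoint_pair_funpow)
qed

text \<open>Taking adjoints reverses the order of the factors: a product of even length becomes the
  one with \<open>P\<close> and \<open>Q\<close> exchanged, while one of odd length is a palindrome
  and thus self-adjoint. This dictates the witness \<open>S\<close>.\<close>

lemma star_strong_limit_alt_prod:
  assumes P: "module_projection ip P" and Q: "module_projection ip Q"
    and L: "adjoint_pair ip L L" "\<And>x. L (Q x) = L x"
    and lim: "\<And>x. (\<lambda>n. ((P \<circ> Q) ^^ n) x) \<longlonglongrightarrow> L x" "\<And>x. (\<lambda>n. ((Q \<circ> P) ^^ n) x) \<longlonglongrightarrow> L x"
  shows "star_strong_limit ip (alt_prod P Q) L"
proof (rule star_strong_limitI[where S = "\<lambda>n. if even n then alt_prod Q P n else alt_prod P Q n"])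
  have adj: "adjoint_pair ip P P" "adjoint_pair ip Q Q"
    using P Q by (simp_all add: module_projection_iff)
  show "adjoint_pair ip (alt_prod P Q n) (if even n then alt_prod Q P n else alt_prod P Q n)" for n
  proof (cases "even n")
    case True
    then obtain k where "n = 2 * k" ..
    then show ?thesis
      using adjoint_pair_funpow[OF adjoint_pair_comp[OF adj]] by (simp add: alt_prod_even)
  next
    case False
    then obtain k where n: "n = Suc (2 * k)"
      by (metis oddE Suc_eq_plus1)
    have "(Q \<circ> P) ^^ k \<circ> Q = Q \<circ> (P \<circ> Q) ^^ k"
      by (simp add: fun_eq_iff funpow_comp_shift)
    then have "adjoint_pair ip ((Q \<circ> P) ^^ k \<circ> Q) ((Q \<circ> P) ^^ k \<circ> Q)"
      using adjoint_pair_comp[OF adjoint_pair_funpow[OF adjoint_pair_comp[OF adj(2,1)]] adj(2), of k]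
      by metis
    then show ?thesis
      using n by (simp only: alt_prod_odd) simp
  qed
  have odd: "(\<lambda>n. alt_prod P Q (Suc (2 * n)) x) \<longlonglongrightarrow> L x" for x
    using lim(2)[of "Q x"] by (simp add: alt_prod_even L(2))
  show "(\<lambda>n. alt_prod P Q n x) \<longlonglongrightarrow> L x" for x
    by (rule tendsto_even_odd[OF _ odd]) (simp add: alt_prod_even lim)
  show "(\<lambda>n. (if even n then alt_prod Q P n else alt_prod P Q n) x) \<longlonglongrightarrow> L x" for x
    by (rule tendsto_even_odd) (use lim(2) odd in \<open>simp_all add: alt_prod_even\<close>)
qed (rule L(1))

theorem alternating_projections:
  assumes P: "module_projection ip P" and Q: "module_projection ip Q"
    and Cauchy: "star_strong_Cauchy ip (\<lambda>n. (P \<circ> Q) ^^ n)"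
  obtains L where "module_projection ip L" "range L = range P \<inter> range Q"
    "\<And>x. (\<lambda>n. ((P \<circ> Q) ^^ n) x) \<longlonglongrightarrow> L x" "\<And>x. (\<lambda>n. ((Q \<circ> P) ^^ n) x) \<longlonglongrightarrow> L x"
proof -
  have adj: "adjoint_pair ip P P" "adjoint_pair ip Q Q"
    using P Q by (simp_all add: module_projection_iff)
  have PQn: "adjoint_pair ip ((P \<circ> Q) ^^ n) ((Q \<circ> P) ^^ n)" for n
    by (intro adjoint_pair_funpow adjoint_pair_comp adj)
  \<comment> \<open>\<open>lim\<close> is meaningful here because Cauchyness in the star-strong
    sense forces pointwise convergence of the powers and of their adjoints.\<close>
  define A where "A x = lim (\<lambda>n. ((P \<circ> Q) ^^ n) x)" for x
  define C where "C x = lim (\<lambda>n. ((Q \<circ> P) ^^ n) x)" for x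
  have A: "(\<lambda>n. ((P \<circ> Q) ^^ n) x) \<longlonglongrightarrow> A x" and C: "(\<lambda>n. ((Q \<circ> P) ^^ n) x) \<longlonglongrightarrow> C x" for x
    unfolding A_def C_def convergent_LIMSEQ_iff[symmetric]
    by (rule star_strong_Cauchy_convergent[OF Cauchy PQn])+
  have AC: "adjoint_pair ip A C"
    unfolding adjoint_pair_def
  proof (intro allI)
    fix x y
    have "(\<lambda>n. ip (((P \<circ> Q) ^^ n) x) y) \<longlonglongrightarrow> ip (A x) y"
      by (rule bounded_linear.tendsto[OF bounded_linear_ip_left A])
    moreover have "(\<lambda>n. ip x (((Q \<circ> P) ^^ n) y)) \<longlonglongrightarrow> ip x (C y)"
      by (rule bounded_linear.tendsto[OF bounded_linear_ip_right C])
    ultimately show "ip (A x) y = ip x (C y)"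
      unfolding adjoint_pairD[OF PQn] by (rule LIMSEQ_unique)
  qed
  \<comment> \<open>The limit is compared with that of the shifted sequence. The projections are
    kept general since both orders are needed.\<close>
  have lim_fixed: "P' (Q' y) = y"
    if "module_projection ip P'" "module_projection ip Q'" and l: "(\<lambda>n. ((P' \<circ> Q') ^^ n) x) \<longlonglongrightarrow> y"
    for P' Q' x y
  proof -
    have "(\<lambda>n. P' (Q' (((P' \<circ> Q') ^^ n) x))) \<longlonglongrightarrow> P' (Q' y)"
      by (rule bounded_linear.tendsto[OF bounded_linear_projection[OF that(1)]
            bounded_linear.tendsto[OF bounded_linear_projection[OF that(2)] l]])
    then show ?thesis
      by (rule LIMSEQ_unique) (use LIMSEQ_Suc[OF l] in simp)
  qed
  have PA: "P (A x) = A x" "Q (A x) = A x" and PC: "Q (C x) = C x" "P (C x) = C x" for x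
    using fixed_of_projection_product[OF P Q lim_fixed[OF P Q A]]
      fixed_of_projection_product[OF Q P lim_fixed[OF Q P C]] by blast+
  have A_fix: "A x = x" if "P x = x" "Q x = x" for x
    using A[of x] that by (simp add: funpow_fixed LIMSEQ_const_iff)
  \<comment> \<open>\<open>C\<close> takes values in the common range, where \<open>A\<close> acts
    as the identity. As \<open>A\<close> and \<open>C\<close> are mutually adjoint,
    \<open>A \<circ> C\<close> is its own adjoint; so \<open>C\<close> is self-adjoint, and
    uniqueness of its adjoint gives \<open>A = C\<close>.\<close>
  have "A \<circ> C = C"
    by (simp add: fun_eq_iff A_fix PC)
  then have "adjoint_pair ip C C"
    using adjoint_pair_comp[OF AC adjoint_pair_sym[OF AC]] by simp
  then have "A = C"
    using module_adjoint_eq[OF adjoint_pair_sym[OF AC]] module_adjoint_eq[of C C] by simp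
  show thesis
  proof (rule that)
    show "module_projection ip A"
      using AC \<open>A = C\<close> \<open>A \<circ> C = C\<close> by (simp add: module_projection_iff)
    show "range A = range P \<inter> range Q"
    proof (intro equalityI subsetI)
      show "y \<in> range P \<inter> range Q" if "y \<in> range A" for y
        using that PA by (auto simp: projection_fixed[OF P] projection_fixed[OF Q])
      show "y \<in> range A" if "y \<in> range P \<inter> range Q" for y
        using that A_fix[of y] by (metis IntE P Q projection_fixed rangeI)
    qed
  qed (use A C \<open>A = C\<close> in auto)
qed

end

theorem proposition2p4:
  fixes ip :: "'x::{complex_normed_vector, banach} \<Rightarrow> 'x \<Rightarrow> 'b::cstar_algebra"
    and act :: "'x \<Rightarrow> 'b \<Rightarrow> 'x"
    and P Q :: "'x \<Rightarrow> 'x"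
  assumes "hilbert_cstar_module ip act"
    and "module_projection ip P"
    and "module_projection ip Q"
    and "star_strong_Cauchy ip (\<lambda>n. (P \<circ> Q) ^^ n)"
  shows "star_strong_Cauchy ip (\<lambda>n. (Q \<circ> P) ^^ n) \<and>
    star_strong_Cauchy ip (\<lambda>n. (P \<circ> Q \<circ> P) ^^ n) \<and>
    star_strong_Cauchy ip (\<lambda>n. (Q \<circ> P \<circ> Q) ^^ n) \<and>
    star_strong_Cauchy ip (alt_prod Q P) \<and>
    star_strong_Cauchy ip (alt_prod P Q) \<and>
    (\<exists>P\<^sub>\<Omega>. module_projection ip P\<^sub>\<Omega> \<and> range P\<^sub>\<Omega> = range P \<inter> range Q \<and>
      star_strong_limit ip (\<lambda>n. (P \<circ> Q) ^^ n) P\<^sub>\<Omega> \<and>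
      star_strong_limit ip (\<lambda>n. (Q \<circ> P) ^^ n) P\<^sub>\<Omega> \<and>
      star_strong_limit ip (\<lambda>n. (P \<circ> Q \<circ> P) ^^ n) P\<^sub>\<Omega> \<and>
      star_strong_limit ip (\<lambda>n. (Q \<circ> P \<circ> Q) ^^ n) P\<^sub>\<Omega> \<and>
      star_strong_limit ip (alt_prod Q P) P\<^sub>\<Omega> \<and>
      star_strong_limit ip (alt_prod P Q) P\<^sub>\<Omega>) \<and>
    complemented ip act (range P \<inter> range Q)"
proof -
  interpret hilbert_cstar_module ip act by (rule assms(1))
  note P = assms(2) and Q = assms(3)
  obtain L where L: "module_projection ip L" and ran: "range L = range P \<inter> range Q"
    and lim: "\<And>x. (\<lambda>n. ((P \<circ> Q) ^^ n) x) \<longlonglongrightarrow> L x" "\<And>x. (\<lambda>n. ((Q \<circ> P) ^^ n) x) \<longlonglongrightarrow> L x"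
    using alternating_projections[OF P Q assms(4)] by blast
  have adj: "adjoint_pair ip P P" "adjoint_pair ip Q Q" "adjoint_pair ip L L"
    using P Q L by (simp_all add: module_projection_iff)
  \<comment> \<open>This is the adjoint of the identity \<open>R \<circ> L = L\<close>, both maps
    being self-adjoint.\<close>
  have absorb: "L (R x) = L x" if R: "adjoint_pair ip R R" and R_L: "\<And>y. R (L y) = L y" for R x
  proof (rule ip_left_eqI)
    fix y
    show "ip y (L (R x)) = ip y (L x)"
      by (simp add: R_L flip: adjoint_pairD[OF adj(3)] adjoint_pairD[OF R])
  qed
  have "P (L y) = L y" "Q (L y) = L y" for y
    using ran projection_fixed[OF P] projection_fixed[OF Q] by blast+
  then have LP: "L (P x) = L x" and LQ: "L (Q x) = L x" for x
    using absorb adj by blast+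
  have lims: "star_strong_limit ip (\<lambda>n. (P \<circ> Q) ^^ n) L"
    "star_strong_limit ip (\<lambda>n. (Q \<circ> P) ^^ n) L"
    "star_strong_limit ip (\<lambda>n. (P \<circ> Q \<circ> P) ^^ n) L"
    "star_strong_limit ip (\<lambda>n. (Q \<circ> P \<circ> Q) ^^ n) L"
    "star_strong_limit ip (alt_prod Q P) L"
    "star_strong_limit ip (alt_prod P Q) L"
    using star_strong_limitI[OF adjoint_pair_funpow[OF adjoint_pair_comp[OF adj(1,2)]] adj(3) lim]
      star_strong_limitI[OF adjoint_pair_funpow[OF adjoint_pair_comp[OF adj(2,1)]] adj(3) lim(2,1)]
      star_strong_limit_PQP[OF P Q adj(3) LP lim(1)] star_strong_limit_PQP[OF Q P adj(3) LQ lim(2)]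
      star_strong_limit_alt_prod[OF Q P adj(3) LP lim(2,1)]
      star_strong_limit_alt_prod[OF P Q adj(3) LQ lim] by auto
  then show ?thesis
    using L ran complemented_range_projection[OF L] star_strong_limit_imp_Cauchy by metis
qed

end
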